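(* Let $\mathcal{M}$ be any deterministic first-order method. Then for every iteration number $T$ (a positive integer) there exist a data matrix $A\in\mathbb{R}^{N\times n}$ and a response vector $b\in\{-1,1\}^N$, where $n=4T+2$ and $N=16T+8$, such that the $T$-th approximate solution $x_T$ generated by $\mathcal{M}$ when minimizing the binary logistic regression loss function $l_{A,b}$ satisfies $$l_{A,b}(x_T)-l_{A,b}^*\ge\frac{3\|A\|^2\|x_0-z^*\|^2}{32(4T+3)(8T+5)},\qquad \|x_T-z^*\|^2>\frac18\|x_0-z^*\|^2,$$ where $z^*$ is the minimizer of $l_{A,b}$.
   Context: $\|\cdot\|$ is the Euclidean norm of a vector and the spectral norm of a matrix. For $A\in\mathbb{R}^{N\times n}$ with rows $a_i^\top$ and $b\in\{-1,1\}^N$, the (homogeneous) binary logistic loss is $$l_{A,b}(x):=h(Ax)-b^\top Ax=\sum_{i=1}^N 2\log\left[1+\exp\left(-b^{(i)}a_i^\top x\right)\right],\quad x\in\mathbb{R}^n,$$ where for a vector $u\in\mathbb{R}^m$ of any dimension $m$, $h(u):=\sum_{i=1}^m 2\log\left[2\cosh\left(u^{(i)}/2\right)\right]$ and $u^{(i)}$ is the $i$-th component of $u$. Also $l_{A,b}^*:=\min_{x\in\mathbb{R}^n}l_{A,b}(x)$. Deterministic first-order method: an iterative algorithm $\mathcal{M}$ for convex problems $\min_{x\in\mathbb{R}^n}f(x)$ (for any dimension $n$) that accesses $f$ only through the oracle $\mathcal{O}_f(x)=(f(x),f'(x))$, where $f'(x)$ is a subgradient of $f$ at $x$ (the gradient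 $\nabla f(x)$ when $f$ is differentiable). It is described by a problem-independent initial iterate $x_0$ and a sequence of deterministic rules $\{\mathcal{I}_t\}_{t\ge0}$ with $x_{t+1}=\mathcal{I}_t(\mathcal{O}_f(x_0),\ldots,\mathcal{O}_f(x_t))$ for all $t\ge0$. Standing assumptions: $x_0=0$, and $x_t$ is both the inquiry point to the oracle and the approximate solution output by $\mathcal{M}$. *)

theory Defs
  imports Complex_Main "Jordan_Normal_Form.Matrix"
begin

text \<open>
  The dimension has to vary with the iteration number, while a method has to be given for all
  dimensions at once. Vectors and matrices are therefore those of \<^theory>\<open>Jordan_Normal_Form.Matrix\<close>,
  with explicit carriers and with components indexed from 0.
\<close>

definition vnorm :: "real vec \<Rightarrow> real" where
  "vnorm v = sqrt (v \<bullet> v)"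

definition spectral_norm :: "real mat \<Rightarrow> real" where
  "spectral_norm A = (SUP x \<in> {x \<in> carrier_vec (dim_col A). vnorm x \<le> 1}. vnorm (A *\<^sub>v x))"

subsection \<open>Binary logistic loss\<close>

definition h :: "real vec \<Rightarrow> real" where
  "h u = (\<Sum>i<dim_vec u. 2 * ln (2 * cosh (u $ i / 2)))"

definition logistic_loss :: "real mat \<Rightarrow> real vec \<Rightarrow> real vec \<Rightarrow> real" where
  "logistic_loss A b x = h (A *\<^sub>v x) - b \<bullet> (A *\<^sub>v x)"

definition is_response :: "nat \<Rightarrow> real vec \<Rightarrow> bool" where
  "is_response N b \<longleftrightarrow> b \<in> carrier_vec N \<and> (\<forall>i<N. b $ i \<in> {-1, 1})"

text \<open>The minimal value; meaningful only if the minimum is attained.\<close>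

definition min_value :: "nat \<Rightarrow> (real vec \<Rightarrow> real) \<Rightarrow> real" where
  "min_value n f = (LEAST v. v \<in> f ` carrier_vec n)"

definition is_the_minimizer :: "nat \<Rightarrow> (real vec \<Rightarrow> real) \<Rightarrow> real vec \<Rightarrow> bool" where
  "is_the_minimizer n f z \<longleftrightarrow> z \<in> carrier_vec n \<and> (\<forall>x\<in>carrier_vec n. x \<noteq> z \<longrightarrow> f z < f x)"

subsection \<open>Deterministic first-order methods\<close>

definition is_subgradient :: "nat \<Rightarrow> (real vec \<Rightarrow> real) \<Rightarrow> real vec \<Rightarrow> real vec \<Rightarrow> bool" where
  "is_subgradient n f x g \<longleftrightarrow>
     g \<in> carrier_vec n \<and> (\<forall>y\<in>carrier_vec n. f y \<ge> f x + g \<bullet> (y - x))"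

text \<open>
  \<open>f'\<close> selects one subgradient at every point, and the oracle answers with \<open>(f x, f' x)\<close>.
  For the logistic loss the only such selection is the gradient, see \<open>subgradient_logistic_loss_iff\<close>.
\<close>

definition subgradient_selection ::
  "nat \<Rightarrow> (real vec \<Rightarrow> real) \<Rightarrow> (real vec \<Rightarrow> real vec) \<Rightarrow> bool" where
  "subgradient_selection n f f' \<longleftrightarrow> (\<forall>x\<in>carrier_vec n. is_subgradient n f x (f' x))"

type_synonym oracle_answer = "real \<times> real vec"

definition first_order_oracle ::
  "(real vec \<Rightarrow> real) \<Rightarrow> (real vec \<Rightarrow> real vec) \<Rightarrow> real vec \<Rightarrow> oracle_answer" where
  "first_order_oracle f f' x = (f x, f' x)"

text \<open>
  Of the problem, the initial iterate and the rules know only the dimension \<open>n\<close> (first argument).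
  The rule \<open>fom_rule M n t\<close> turns the answers at \<open>x\<^sub>0, \<dots>, x\<^sub>t\<close>, in this order, into \<open>x\<^sub>t\<^sub>+\<^sub>1\<close>.
\<close>

record fom =
  fom_init :: "nat \<Rightarrow> real vec"
  fom_rule :: "nat \<Rightarrow> nat \<Rightarrow> oracle_answer list \<Rightarrow> real vec"

definition deterministic_fom :: "fom \<Rightarrow> bool" where
  "deterministic_fom M \<longleftrightarrow>
     (\<forall>n. fom_init M n \<in> carrier_vec n) \<and>
     (\<forall>n t os. length os = Suc t \<and> snd ` set os \<subseteq> carrier_vec n
        \<longrightarrow> fom_rule M n t os \<in> carrier_vec n)"

fun iterate :: "fom \<Rightarrow> nat \<Rightarrow> (real vec \<Rightarrow> oracle_answer) \<Rightarrow> nat \<Rightarrow> real vec" where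
  "iterate M n O_f 0 = fom_init M n"
| "iterate M n O_f (Suc t) = fom_rule M n t (map (\<lambda>s. O_f (iterate M n O_f s)) [0..<Suc t])"

subsection \<open>The logistic loss in its second form, and its subgradients\<close>

lemma ln_2_cosh_half:
  fixes u b :: real
  assumes "b \<in> {-1, 1}"
  shows "2 * ln (2 * cosh (u / 2)) - b * u = 2 * ln (1 + exp (- b * u))"
proof -
  have *: "ln (2 * cosh (v / 2)) = v / 2 + ln (1 + exp (- v))" for v :: real
  proof -
    have "2 * cosh (v / 2) = exp (v / 2) * (1 + exp (- v))"
      by (simp add: cosh_def scaleR_conv_of_real distrib_left flip: exp_add)
    moreover have "1 + exp (- v) > 0" by (simp add: add_pos_pos)
    ultimately show ?thesis by (simp add: ln_mult)
  qed
  from assms consider "b = 1" | "b = -1" by auto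
  thus ?thesis
  proof cases
    case 1
    show ?thesis unfolding 1 *[of u] by simp
  next
    case 2
    have "cosh (u / 2) = cosh (- u / 2)" by simp
    thus ?thesis unfolding 2 using *[of "- u"] by (simp only:) simp
  qed
qed

lemma logistic_loss_eq_sum_log:
  assumes A: "A \<in> carrier_mat N n" and b: "is_response N b"
  shows "logistic_loss A b x = (\<Sum>i<N. 2 * ln (1 + exp (- b $ i * (row A i \<bullet> x))))"
proof -
  have "logistic_loss A b x
      = (\<Sum>i<N. 2 * ln (2 * cosh (row A i \<bullet> x / 2)) - b $ i * (row A i \<bullet> x))"
    using A by (simp add: logistic_loss_def h_def scalar_prod_def[of b] sum_subtractf
        atLeast0LessThan)
  also have "\<dots> = (\<Sum>i<N. 2 * ln (1 + exp (- b $ i * (row A i \<bullet> x))))"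
    using b by (intro sum.cong refl ln_2_cosh_half) (auto simp: is_response_def)
  finally show ?thesis .
qed

definition logistic_gradient :: "real mat \<Rightarrow> real vec \<Rightarrow> real vec \<Rightarrow> real vec" where
  "logistic_gradient A b x = transpose_mat A *\<^sub>v (map_vec (\<lambda>u. tanh (u / 2)) (A *\<^sub>v x) - b)"

lemma logistic_gradient_carrier:
  assumes "A \<in> carrier_mat N n" and "b \<in> carrier_vec N"
  shows "logistic_gradient A b x \<in> carrier_vec n"
proof -
  have "map_vec (\<lambda>u. tanh (u / 2)) (A *\<^sub>v x) - b \<in> carrier_vec N"
    by (rule carrier_vecI) (use assms(2) in simp)
  with assms(1) show ?thesis
    unfolding logistic_gradient_def by (intro mult_mat_vec_carrier[of _ _ N]) simp_all
qed

lemma has_derivative_ln_2_cosh: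
  "((\<lambda>u::real. 2 * ln (2 * cosh (u / 2))) has_field_derivative tanh (u / 2)) (at u)"
  by (auto intro!: derivative_eq_intros simp: tanh_def field_simps)

lemma ln_2_cosh_tangent:
  fixes u v :: real
  shows "2 * ln (2 * cosh (v / 2)) \<ge> 2 * ln (2 * cosh (u / 2)) + tanh (u / 2) * (v - u)"
proof -
  let ?f = "\<lambda>u::real. 2 * ln (2 * cosh (u / 2))"
  consider "u < v" | "v < u" | "u = v" by linarith
  thus ?thesis
  proof cases
    case 1
    then obtain w where w: "u < w" "w < v" "?f v - ?f u = (v - u) * tanh (w / 2)"
      using MVT2[of u v ?f "\<lambda>w. tanh (w / 2)"] has_derivative_ln_2_cosh by blast
    have "(v - u) * tanh (u / 2) \<le> (v - u) * tanh (w / 2)"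
      using 1 w by (intro mult_left_mono) auto
    moreover have "tanh (u / 2) * (v - u) = (v - u) * tanh (u / 2)"
      by (rule mult.commute)
    ultimately show ?thesis using w(3) by linarith
  next
    case 2
    then obtain w where w: "v < w" "w < u" "?f u - ?f v = (u - v) * tanh (w / 2)"
      using MVT2[of v u ?f "\<lambda>w. tanh (w / 2)"] has_derivative_ln_2_cosh by blast
    have "(u - v) * tanh (w / 2) \<le> (u - v) * tanh (u / 2)"
      using 2 w by (intro mult_left_mono) auto
    moreover have "tanh (u / 2) * (v - u) = - ((u - v) * tanh (u / 2))"
      by (simp add: algebra_simps)
    ultimately show ?thesis using w(3) by linarith
  qed simp
qed

lemma logistic_gradient_scalar_prod:
  assumes A: "A \<in> carrier_mat N n" and b: "b \<in> carrier_vec N"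
    and x: "x \<in> carrier_vec n" and d: "d \<in> carrier_vec n"
  shows "logistic_gradient A b x \<bullet> d
    = (\<Sum>i<N. (tanh ((A *\<^sub>v x) $ i / 2) - b $ i) * ((A *\<^sub>v d) $ i))"
proof -
  let ?w = "map_vec (\<lambda>u. tanh (u / 2)) (A *\<^sub>v x) - b"
  have w: "?w \<in> carrier_vec N" by (rule carrier_vecI) (use b in simp)
  have "logistic_gradient A b x \<bullet> d = d \<bullet> (transpose_mat A *\<^sub>v ?w)"
    unfolding logistic_gradient_def
    by (rule comm_scalar_prod[OF _ d])
      (use logistic_gradient_carrier[OF A b] in \<open>simp add: logistic_gradient_def\<close>)
  also have "\<dots> = (A *\<^sub>v d) \<bullet> ?w"
  proof -
    have "d \<bullet> (transpose_mat A *\<^sub>v ?w) = (\<Sum>j<n. \<Sum>i<N. d $ j * (A $$ (i, j) * ?w $ i))"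
      using A w d by (simp add: scalar_prod_def atLeast0LessThan sum_distrib_left
          del: index_minus_vec index_map_vec)
    also have "\<dots> = (\<Sum>i<N. \<Sum>j<n. d $ j * (A $$ (i, j) * ?w $ i))"
      by (rule sum.swap)
    also have "\<dots> = (A *\<^sub>v d) \<bullet> ?w"
      using A w d by (simp add: scalar_prod_def atLeast0LessThan sum_distrib_right mult_ac
          del: index_minus_vec index_map_vec)
    finally show ?thesis .
  qed
  also have "\<dots> = (\<Sum>i<N. (tanh ((A *\<^sub>v x) $ i / 2) - b $ i) * ((A *\<^sub>v d) $ i))"
    using A b by (simp add: scalar_prod_def[of _ ?w] atLeast0LessThan mult.commute)
  finally show ?thesis .
qed

lemma logistic_loss_expand:
  assumes A: "A \<in> carrier_mat N n" and b: "b \<in> carrier_vec N"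
  shows "logistic_loss A b x
    = (\<Sum>i<N. 2 * ln (2 * cosh ((A *\<^sub>v x) $ i / 2)) - b $ i * ((A *\<^sub>v x) $ i))"
  using A b by (simp add: logistic_loss_def h_def scalar_prod_def[of b] sum_subtractf
      atLeast0LessThan)

lemma subgradient_logistic_loss_iff:
  assumes A: "A \<in> carrier_mat N n" and b: "b \<in> carrier_vec N" and x: "x \<in> carrier_vec n"
  shows "is_subgradient n (logistic_loss A b) x g \<longleftrightarrow> g = logistic_gradient A b x"
proof
  assume g: "g = logistic_gradient A b x"
  have "logistic_loss A b y \<ge> logistic_loss A b x + g \<bullet> (y - x)" if y: "y \<in> carrier_vec n" for y
  proof -
    have d: "y - x \<in> carrier_vec n" using x y by simp
    have *: "A *\<^sub>v (y - x) = A *\<^sub>v y - A *\<^sub>v x"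
      by (rule mult_minus_distrib_mat_vec[OF A y x])
    show ?thesis
      unfolding g logistic_loss_expand[OF A b] logistic_gradient_scalar_prod[OF A b x d]
        sum.distrib[symmetric]
    proof (rule sum_mono)
      fix i assume "i \<in> {..<N}"
      hence d: "(A *\<^sub>v (y - x)) $ i = (A *\<^sub>v y) $ i - (A *\<^sub>v x) $ i"
        using A unfolding * by simp
      show "2 * ln (2 * cosh ((A *\<^sub>v x) $ i / 2)) - b $ i * (A *\<^sub>v x) $ i
          + (tanh ((A *\<^sub>v x) $ i / 2) - b $ i) * (A *\<^sub>v (y - x)) $ i
        \<le> 2 * ln (2 * cosh ((A *\<^sub>v y) $ i / 2)) - b $ i * (A *\<^sub>v y) $ i"
        using ln_2_cosh_tangent[of "(A *\<^sub>v x) $ i" "(A *\<^sub>v y) $ i"]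
        unfolding d by (simp add: algebra_simps)
    qed
  qed
  moreover have "g \<in> carrier_vec n" using logistic_gradient_carrier[OF A b] g by simp
  ultimately show "is_subgradient n (logistic_loss A b) x g" by (simp add: is_subgradient_def)
next
  assume sg: "is_subgradient n (logistic_loss A b) x g"
  hence gn: "g \<in> carrier_vec n" by (simp add: is_subgradient_def)
  have eq: "g \<bullet> d = logistic_gradient A b x \<bullet> d" if d: "d \<in> carrier_vec n" for d
  proof -
    let ?p = "\<lambda>t::real. (\<Sum>i<N. 2 * ln (2 * cosh (((A *\<^sub>v x) $ i + t * (A *\<^sub>v d) $ i) / 2))
        - b $ i * ((A *\<^sub>v x) $ i + t * (A *\<^sub>v d) $ i)) - t * (g \<bullet> d)"
    have p: "?p t = logistic_loss A b (x + t \<cdot>\<^sub>v d) - t * (g \<bullet> d)" for t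
    proof -
      have td: "t \<cdot>\<^sub>v d \<in> carrier_vec n" using d by simp
      have "A *\<^sub>v (x + t \<cdot>\<^sub>v d) = A *\<^sub>v x + t \<cdot>\<^sub>v (A *\<^sub>v d)"
        using mult_add_distrib_mat_vec[OF A x td] mult_mat_vec[OF A d] by simp
      hence "(A *\<^sub>v (x + t \<cdot>\<^sub>v d)) $ i = (A *\<^sub>v x) $ i + t * (A *\<^sub>v d) $ i" if "i < N" for i
        using A that by simp
      thus ?thesis unfolding logistic_loss_expand[OF A b] by simp
    qed
    have min: "?p 0 \<le> ?p t" for t
    proof -
      have "x + t \<cdot>\<^sub>v d \<in> carrier_vec n" using x d by simp
      hence "logistic_loss A b (x + t \<cdot>\<^sub>v d)
          \<ge> logistic_loss A b x + g \<bullet> (x + t \<cdot>\<^sub>v d - x)"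
        using sg unfolding is_subgradient_def by blast
      moreover have "x + t \<cdot>\<^sub>v d - x = t \<cdot>\<^sub>v d" using x d by (intro eq_vecI) auto
      moreover have "x + 0 \<cdot>\<^sub>v d = x" using x d by (intro eq_vecI) auto
      ultimately show ?thesis unfolding p using gn d by simp
    qed
    have "(?p has_field_derivative
        ((\<Sum>i<N. tanh (((A *\<^sub>v x) $ i + 0 * (A *\<^sub>v d) $ i) / 2) * (A *\<^sub>v d) $ i
          - b $ i * (A *\<^sub>v d) $ i) - g \<bullet> d)) (at 0)"
    proof (intro derivative_intros DERIV_diff DERIV_sum)
      fix i
      show "((\<lambda>t::real. 2 * ln (2 * cosh (((A *\<^sub>v x) $ i + t * (A *\<^sub>v d) $ i) / 2)))
        has_field_derivative
          tanh (((A *\<^sub>v x) $ i + 0 * (A *\<^sub>v d) $ i) / 2) * (A *\<^sub>v d) $ i) (at 0)"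
        by (rule DERIV_chain2[OF has_derivative_ln_2_cosh]) (auto intro!: derivative_eq_intros)
    qed (auto intro!: derivative_eq_intros)
    from DERIV_local_min[OF this, of 1] min
    have "(\<Sum>i<N. tanh ((A *\<^sub>v x) $ i / 2) * (A *\<^sub>v d) $ i - b $ i * (A *\<^sub>v d) $ i) = g \<bullet> d"
      by simp
    thus ?thesis
      unfolding logistic_gradient_scalar_prod[OF A b x d] by (simp add: left_diff_distrib)
  qed
  have Gn: "logistic_gradient A b x \<in> carrier_vec n"
    by (rule logistic_gradient_carrier[OF A b])
  show "g = logistic_gradient A b x"
  proof (rule eq_vecI)
    fix i assume "i < dim_vec (logistic_gradient A b x)"
    hence i: "i < n" using Gn by simp
    show "g $ i = logistic_gradient A b x $ i"
      using eq[of "unit_vec n i"] i gn Gn by simp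
  qed (use gn Gn in auto)
qed

end

theory Submission
  imports Defs
begin

text \<open>
  Let \<open>y\<^sub>q = c\<^sub>q - c\<^sub>q\<^sub>+\<^sub>1\<close> (with \<open>c\<^sub>n = 0\<close>) and take every row \<open>y\<^sub>q\<close> four times, with three labels
  \<open>1\<close> and one label \<open>-1\<close>. The loss becomes \<open>\<Sum>q<n. p (y\<^sub>q)\<close> for a strictly convex \<open>p\<close> with minimum at
  \<open>ln 3\<close>, so its minimizer is \<open>ln 3 \<cdot> (n, \<dots>, 2, 1)\<close>. At a point supported on the first \<open>m\<close> coordinates
  the gradient is supported on the first \<open>m + 1\<close>. The data are \<open>A = W V\<close> with \<open>W\<close> the matrix of this
  chain and \<open>V\<close> an orthogonal matrix chosen against the method: whenever an iterate \<open>x\<^sub>t\<close> is produced,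
  a reflection of the coordinates that earlier oracle answers did not reveal moves the new part of
  \<open>V x\<^sub>t\<close> into a single coordinate. So \<open>V x\<^sub>t\<close> is supported on the first \<open>2t\<close> coordinates, \<open>V x\<^sub>T\<close> has
  \<open>y\<^sub>q = 0\<close> for more than half of the \<open>q\<close>, and both the gap and the distance are estimated on these.
\<close>

text \<open>Support within the first \<open>k\<close> coordinates. Indices past the dimension are
  excluded, since \<open>$\<close> says nothing useful there.\<close>

definition vanishes_from :: "nat \<Rightarrow> real vec \<Rightarrow> bool" where
  "vanishes_from k v \<longleftrightarrow> (\<forall>i. k \<le> i \<longrightarrow> i < dim_vec v \<longrightarrow> v $ i = 0)"

lemma vanishes_fromD: "vanishes_from k v \<Longrightarrow> k \<le> i \<Longrightarrow> i < dim_vec v \<Longrightarrow> v $ i = 0"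
  by (simp add: vanishes_from_def)

lemma vanishes_from_mono: "vanishes_from k v \<Longrightarrow> k \<le> l \<Longrightarrow> vanishes_from l v"
  by (auto simp: vanishes_from_def)

lemma scalar_prod_real_sum:
  fixes v w :: "real vec"
  shows "dim_vec w = n \<Longrightarrow> v \<bullet> w = (\<Sum>i<n. v $ i * w $ i)"
  by (simp add: scalar_prod_def atLeast0LessThan)

lemma vnorm_power2: "(vnorm v)\<^sup>2 = (\<Sum>i<dim_vec v. (v $ i)\<^sup>2)"
  by (simp add: vnorm_def scalar_prod_real_sum power2_eq_square sum_nonneg)

lemma vnorm_nonneg: "vnorm v \<ge> 0"
  by (simp add: vnorm_def scalar_prod_real_sum sum_nonneg)

subsection \<open>Orthogonal matrices\<close>

definition orthogonal :: "nat \<Rightarrow> real mat \<Rightarrow> bool" where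
  "orthogonal n V \<longleftrightarrow> V \<in> carrier_mat n n \<and> V\<^sup>T * V = 1\<^sub>m n \<and> V * V\<^sup>T = 1\<^sub>m n"

lemma orthogonal_one: "orthogonal n (1\<^sub>m n)"
  by (simp add: orthogonal_def)

lemma orthogonal_mult:
  assumes "orthogonal n Q" "orthogonal n V"
  shows "orthogonal n (Q * V)"
proof -
  have c: "Q \<in> carrier_mat n n" "V \<in> carrier_mat n n" "Q\<^sup>T \<in> carrier_mat n n" "V\<^sup>T \<in> carrier_mat n n"
    using assms by (auto simp: orthogonal_def)
  have "(Q * V)\<^sup>T * (Q * V) = V\<^sup>T * (Q\<^sup>T * (Q * V))"
    using c by (simp add: transpose_mult[of Q n n V n] assoc_mult_mat[of _ n n _ n _ n])
  also have "Q\<^sup>T * (Q * V) = (Q\<^sup>T * Q) * V"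
    using c by (simp add: assoc_mult_mat[of _ n n _ n _ n])
  also have "V\<^sup>T * (Q\<^sup>T * Q * V) = 1\<^sub>m n"
    using assms c by (simp add: orthogonal_def)
  finally have 1: "(Q * V)\<^sup>T * (Q * V) = 1\<^sub>m n" .
  have "(Q * V) * (Q * V)\<^sup>T = Q * (V * (V\<^sup>T * Q\<^sup>T))"
    using c by (simp add: transpose_mult[of Q n n V n] assoc_mult_mat[of _ n n _ n _ n])
  also have "V * (V\<^sup>T * Q\<^sup>T) = (V * V\<^sup>T) * Q\<^sup>T"
    using c by (simp add: assoc_mult_mat[of _ n n _ n _ n])
  also have "Q * (V * V\<^sup>T * Q\<^sup>T) = 1\<^sub>m n"
    using assms c by (simp add: orthogonal_def)
  finally show ?thesis using 1 c by (simp add: orthogonal_def)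
qed

lemma orthogonal_vnorm:
  assumes "orthogonal n V" "x \<in> carrier_vec n"
  shows "vnorm (V *\<^sub>v x) = vnorm x"
proof -
  have V: "V \<in> carrier_mat n n" using assms by (simp add: orthogonal_def)
  have "(V *\<^sub>v x) \<bullet> (V *\<^sub>v x) = (V\<^sup>T *\<^sub>v (V *\<^sub>v x)) \<bullet> x"
    using transpose_vec_mult_scalar[OF V assms(2), of "V *\<^sub>v x"] V assms(2)
    by simp
  also have "V\<^sup>T *\<^sub>v (V *\<^sub>v x) = x"
    using assms V by (simp add: orthogonal_def flip: assoc_mult_mat_vec[of _ n n _ n])
  finally show ?thesis by (simp add: vnorm_def)
qed

text \<open>The reflection along \<open>w\<close> exchanges the tail of \<open>c\<close> with a multiple of the \<open>k\<close>-th unit vector.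
  If \<open>w = 0\<close>, division by zero turns the formula for \<open>Q\<close> into the identity, as it should be.\<close>

lemma householder:
  assumes c: "c \<in> carrier_vec n" and k: "k < n"
  obtains Q where "orthogonal n Q" "Q\<^sup>T = Q"
    "\<And>v. v \<in> carrier_vec n \<Longrightarrow> vanishes_from k v \<Longrightarrow> Q *\<^sub>v v = v"
    "vanishes_from (Suc k) (Q *\<^sub>v c)"
proof -
  \<comment> \<open>\<open>w\<close> is the tail of \<open>c\<close> from \<open>k\<close> on, minus
    its length \<open>r\<close> times the \<open>k\<close>-th unit vector; \<open>Q\<close> is the
    reflection in the hyperplane orthogonal to \<open>w\<close>, and \<open>d\<close> is the squared
    length of \<open>w\<close>.\<close>
  define r where "r = sqrt (\<Sum>i\<in>{k..<n}. (c $ i)\<^sup>2)"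
  define w where "w = (\<lambda>i. if i < k then 0 else if i = k then c $ k - r else c $ i)"
  define d where "d = (\<Sum>i<n. (w i)\<^sup>2)"
  define Q where "Q = mat n n (\<lambda>(i, j). (if i = j then 1 else 0) - 2 / d * w i * w j)"
  have QC: "Q \<in> carrier_mat n n" by (simp add: Q_def)
  have QT: "Q\<^sup>T = Q" by (rule eq_matI) (auto simp: Q_def)
  have Qv: "(Q *\<^sub>v v) $ i = v $ i - 2 / d * (\<Sum>j<n. w j * v $ j) * w i"
    if "v \<in> carrier_vec n" "i < n" for v i
  proof -
    have "(Q *\<^sub>v v) $ i = (\<Sum>j<n. ((if i = j then 1 else 0) - 2 / d * w i * w j) * v $ j)"
      using that by (simp add: Q_def scalar_prod_real_sum)
    also have "\<dots> = (\<Sum>j<n. (if i = j then v $ j else 0) - 2 / d * w i * (w j * v $ j))"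
      by (intro sum.cong) (auto simp: algebra_simps)
    also have "\<dots> = v $ i - 2 / d * w i * (\<Sum>j<n. w j * v $ j)"
      using that by (simp add: sum_subtractf sum_distrib_left)
    finally show ?thesis by (simp add: mult_ac)
  qed
  have QQ: "Q * Q = 1\<^sub>m n"
  proof (rule eq_matI)
    fix i j assume "i < dim_row (1\<^sub>m n :: real mat)" "j < dim_col (1\<^sub>m n :: real mat)"
    hence ij: "i < n" "j < n" by auto
    have cj: "col Q j \<in> carrier_vec n" using QC ij by simp
    have "(Q * Q) $$ (i, j) = (Q *\<^sub>v col Q j) $ i" using QC ij by simp
    also have "\<dots> = Q $$ (i, j) - 2 / d * (\<Sum>l<n. w l * Q $$ (l, j)) * w i"
      using Qv[OF cj ij(1)] QC ij by simp
    also have "(\<Sum>l<n. w l * Q $$ (l, j)) = (\<Sum>l<n. (if l = j then w l else 0) - 2 / d * w j * (w l)\<^sup>2)"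
      using ij by (intro sum.cong) (auto simp: Q_def algebra_simps power2_eq_square)
    also have "\<dots> = w j - 2 / d * w j * d"
      using ij by (simp only: sum_subtractf d_def flip: sum_distrib_left) simp
    finally have "(Q * Q) $$ (i, j)
      = (if i = j then 1 else 0) - 2 / d * w i * w j - 2 / d * (w j - 2 / d * w j * d) * w i"
      using ij by (simp add: Q_def)
    also have "\<dots> = (if i = j then 1 else 0)" by (cases "d = 0") (auto simp: algebra_simps)
    finally show "(Q * Q) $$ (i, j) = 1\<^sub>m n $$ (i, j)" using ij by simp
  qed (use QC in auto)
  have fixed: "Q *\<^sub>v v = v" if v: "v \<in> carrier_vec n" "vanishes_from k v" for v
  proof (rule eq_vecI)
    have "(\<Sum>j<n. w j * v $ j) = 0"
      using v by (intro sum.neutral) (auto simp: w_def vanishes_from_def)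
    thus "(Q *\<^sub>v v) $ i = v $ i" if "i < dim_vec v" for i
      using Qv[OF v(1)] v that by simp
  qed (use QC v in auto)
  have split: "(\<Sum>i<n. g i) = (\<Sum>i<k. g i) + g k + (\<Sum>i\<in>{Suc k..<n}. g i)" for g :: "nat \<Rightarrow> real"
  proof -
    have "{..<n} = {..<k} \<union> {k..<n}" using k by auto
    hence "(\<Sum>i<n. g i) = (\<Sum>i<k. g i) + (\<Sum>i\<in>{k..<n}. g i)"
      by (simp add: sum.union_disjoint ivl_disj_int)
    thus ?thesis using k by (simp add: sum.atLeast_Suc_lessThan)
  qed
  define s where "s = (\<Sum>i\<in>{Suc k..<n}. (c $ i)\<^sup>2)"
  have r2: "r\<^sup>2 = (c $ k)\<^sup>2 + s"
    using k by (simp add: r_def s_def sum_nonneg sum.atLeast_Suc_lessThan[of k n])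
  have wc: "(\<Sum>j<n. w j * c $ j) = (c $ k - r) * c $ k + s"
    unfolding split s_def by (simp add: w_def power2_eq_square)
  have d: "d = (c $ k - r)\<^sup>2 + s"
    unfolding d_def split s_def by (simp add: w_def)
  \<comment> \<open>Since \<open>r\<close> is the length of the tail, the squared length of
    \<open>w\<close> is twice its product with \<open>c\<close>. So for nonzero \<open>d\<close> the
    reflection subtracts exactly \<open>w\<close> from \<open>c\<close>, and \<open>w\<close> agrees
    with \<open>c\<close> after \<open>k\<close>.\<close>
  have d2: "d = 2 * (\<Sum>j<n. w j * c $ j)"
    using r2 unfolding d wc by (simp add: power2_eq_square algebra_simps)
  have "vanishes_from (Suc k) (Q *\<^sub>v c)"
    unfolding vanishes_from_def
  proof (intro allI impI)
    fix i assume i: "Suc k \<le> i" "i < dim_vec (Q *\<^sub>v c)"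
    hence "i < n" using QC by simp
    have wi: "w i = c $ i" using i by (simp add: w_def)
    show "(Q *\<^sub>v c) $ i = 0"
    proof (cases "d = 0")
      case True
      hence "(w i)\<^sup>2 = 0" using \<open>i < n\<close> by (auto simp: d_def sum_nonneg_eq_0_iff)
      thus ?thesis using Qv[OF c \<open>i < n\<close>] wi by simp
    next
      case False
      thus ?thesis using Qv[OF c \<open>i < n\<close>] wi d2 by simp
    qed
  qed
  thus ?thesis using that[of Q] QC QT QQ fixed by (simp add: orthogonal_def)
qed

subsection \<open>The chain\<close>

text \<open>In the last block \<open>Suc (i div 4)\<close> is no column, so those rows are unit
  vectors; this is the convention that the entry after the last is 0.\<close>

definition chain_matrix :: "nat \<Rightarrow> real mat" where
  "chain_matrix n = mat (4 * n) n
     (\<lambda>(i, j). (if j = i div 4 then 1 else 0) - (if j = Suc (i div 4) then 1 else 0))"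

definition chain_response :: "nat \<Rightarrow> real vec" where
  "chain_response n = vec (4 * n) (\<lambda>i. if i mod 4 = 3 then - 1 else 1)"

definition diff_vec :: "real vec \<Rightarrow> nat \<Rightarrow> real" where
  "diff_vec c q = c $ q - (if Suc q < dim_vec c then c $ Suc q else 0)"

text \<open>The loss of one block of four rows with common value \<open>y\<close>; the labels of the
  block add up to 2. The derivative is \<open>4 * tanh (y / 2) - 2\<close>.\<close>

definition chain_potential :: "real \<Rightarrow> real" where
  "chain_potential y = 8 * ln (2 * cosh (y / 2)) - 2 * y"

lemma chain_matrix_carrier: "chain_matrix n \<in> carrier_mat (4 * n) n"
  by (simp add: chain_matrix_def)

lemma chain_response_carrier: "chain_response n \<in> carrier_vec (4 * n)"
  by (simp add: chain_response_def)

lemma chain_matrix_mult: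
  assumes c: "c \<in> carrier_vec n" and i: "i < 4 * n"
  shows "(chain_matrix n *\<^sub>v c) $ i = diff_vec c (i div 4)"
proof -
  have "i div 4 < n" using i by auto
  moreover have "(chain_matrix n *\<^sub>v c) $ i
      = (\<Sum>j<n. (if j = i div 4 then c $ j else 0) - (if j = Suc (i div 4) then c $ j else 0))"
    using assms by (simp add: chain_matrix_def scalar_prod_real_sum if_distrib cong: sum.cong)
      (intro sum.cong, auto)
  ultimately show ?thesis
    using c by (simp add: sum_subtractf diff_vec_def)
qed

lemma div_mod_4:
  "Suc (4 * q) div 4 = q" "Suc (Suc (4 * q)) div 4 = q" "Suc (Suc (Suc (4 * q))) div 4 = q"
  "Suc (4 * q) mod 4 = 1" "Suc (Suc (4 * q)) mod 4 = 2" "Suc (Suc (Suc (4 * q))) mod 4 = 3"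
  by presburger+

lemma sum_blocks_of_4:
  fixes g :: "nat \<Rightarrow> real"
  shows "(\<Sum>i<4 * n. g i) = (\<Sum>q<n. g (4 * q) + g (Suc (4 * q)) + g (Suc (Suc (4 * q)))
    + g (Suc (Suc (Suc (4 * q)))))"
  by (induction n) (simp_all add: algebra_simps eval_nat_numeral)

lemma chain_loss:
  assumes c: "c \<in> carrier_vec n"
  shows "logistic_loss (chain_matrix n) (chain_response n) c
    = (\<Sum>q<n. chain_potential (diff_vec c q))"
proof -
  have "logistic_loss (chain_matrix n) (chain_response n) c
    = (\<Sum>i<4 * n. 2 * ln (2 * cosh (diff_vec c (i div 4) / 2))
        - (if i mod 4 = 3 then - 1 else 1) * diff_vec c (i div 4))"
    using c unfolding logistic_loss_expand[OF chain_matrix_carrier chain_response_carrier]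
    by (intro sum.cong) (auto simp: chain_matrix_mult chain_response_def)
  also have "\<dots> = (\<Sum>q<n. chain_potential (diff_vec c q))"
    unfolding sum_blocks_of_4 by (intro sum.cong) (auto simp: chain_potential_def div_mod_4)
  finally show ?thesis .
qed

text \<open>With \<open>g\<close> the derivative of \<open>chain_potential\<close>, the
  \<open>j\<close>-th partial derivative is \<open>g\<close> at difference \<open>j\<close> minus
  \<open>g\<close> at difference \<open>j - 1\<close>. For \<open>j > m\<close> both differences are
  0 and the two terms cancel.\<close>

lemma chain_gradient_vanishes:
  assumes c: "c \<in> carrier_vec n" and m: "vanishes_from m c"
  shows "vanishes_from (Suc m) (logistic_gradient (chain_matrix n) (chain_response n) c)"
  unfolding vanishes_from_def
proof (intro allI impI)
  let ?G = "logistic_gradient (chain_matrix n) (chain_response n) c"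
  have G: "?G \<in> carrier_vec n"
    by (rule logistic_gradient_carrier[OF chain_matrix_carrier chain_response_carrier])
  fix j assume mj: "Suc m \<le> j" and "j < dim_vec ?G"
  hence j: "j < n" using G by simp
  define g where "g y = 4 * tanh (y / 2) - 2" for y :: real
  have y0: "diff_vec c q = 0" if "m \<le> q" "q < n" for q
    using that m c by (auto simp: diff_vec_def vanishes_from_def)
  \<comment> \<open>The truncated \<open>j - 1\<close> is the true predecessor, because
    \<open>Suc m \<le> j\<close>.\<close>
  have dj: "diff_vec (unit_vec n j) q = (if q = j then 1 else 0) - (if q = j - 1 then 1 else 0)"
    if "q < n" for q
    using that j mj by (auto simp: diff_vec_def)
  have "?G $ j = ?G \<bullet> unit_vec n j" using G j by simp
  also have "\<dots> = (\<Sum>i<4 * n. (tanh (diff_vec c (i div 4) / 2) - (if i mod 4 = 3 then - 1 else 1))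
      * diff_vec (unit_vec n j) (i div 4))"
    unfolding logistic_gradient_scalar_prod[OF chain_matrix_carrier chain_response_carrier c unit_vec_carrier]
    using c by (intro sum.cong) (auto simp: chain_matrix_mult chain_response_def)
  also have "\<dots> = (\<Sum>q<n. g (diff_vec c q) * diff_vec (unit_vec n j) q)"
    unfolding sum_blocks_of_4 by (intro sum.cong refl) (simp add: div_mod_4, simp add: g_def algebra_simps)
  also have "\<dots> = (\<Sum>q<n. (if q = j then g (diff_vec c q) else 0) - (if q = j - 1 then g (diff_vec c q) else 0))"
    by (intro sum.cong) (auto simp: dj)
  also have "\<dots> = g (diff_vec c j) - g (diff_vec c (j - 1))"
    using j mj by (simp add: sum_subtractf)
  also have "\<dots> = 0" using y0[of j] y0[of "j - 1"] j mj by simp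
  finally show "?G $ j = 0" .
qed

lemma tanh_half_ln_3: "tanh (ln 3 / 2 :: real) = 1 / 2"
  by (simp add: tanh_real_altdef exp_minus)

text \<open>As \<open>tanh\<close> is strictly increasing and
  \<open>tanh (ln 3 / 2) = 1 / 2\<close>, the derivative is negative to the left of
  \<open>ln 3\<close> and positive to the right.\<close>

lemma chain_potential_min: "y \<noteq> ln 3 \<Longrightarrow> chain_potential (ln 3) < chain_potential y"
proof -
  assume ne: "y \<noteq> ln 3"
  have D: "(chain_potential has_field_derivative 4 * tanh (u / 2) - 2) (at u)" for u
    unfolding chain_potential_def
    by (auto intro!: derivative_eq_intros simp: tanh_def field_simps)
  show ?thesis
  proof (cases "y < ln 3")
    case True
    then obtain w where w: "w < ln 3"
      "chain_potential (ln 3) - chain_potential y = (ln 3 - y) * (4 * tanh (w / 2) - 2)"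
      using MVT2[of y "ln 3" chain_potential "\<lambda>w. 4 * tanh (w / 2) - 2"] D by blast
    have "tanh (w / 2) < tanh (ln 3 / 2)" using w by simp
    hence "(ln 3 - y) * (4 * tanh (w / 2) - 2) < 0"
      using True by (intro mult_pos_neg) (auto simp: tanh_half_ln_3)
    thus ?thesis using w by linarith
  next
    case False
    hence "ln 3 < y" using ne by simp
    then obtain w where w: "ln 3 < w"
      "chain_potential y - chain_potential (ln 3) = (y - ln 3) * (4 * tanh (w / 2) - 2)"
      using MVT2[of "ln 3" y chain_potential "\<lambda>w. 4 * tanh (w / 2) - 2"] D by blast
    have "tanh (ln 3 / 2) < tanh (w / 2)" using w by simp
    hence "(y - ln 3) * (4 * tanh (w / 2) - 2) > 0"
      using \<open>ln 3 < y\<close> by (intro mult_pos_pos) (auto simp: tanh_half_ln_3)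
    thus ?thesis using w by linarith
  qed
qed

lemma chain_potential_min_le: "chain_potential (ln 3) \<le> chain_potential y"
  using chain_potential_min[of y] by (cases "y = ln 3") auto

text \<open>The numerical heart of the loss bound: leaving one difference at 0 costs
  \<open>2 * ln (27 / 16)\<close>, at least half the square of the distance from 0 to the optimal
  difference.\<close>

lemma chain_potential_gap: "(ln 3)\<^sup>2 \<le> 2 * (chain_potential 0 - chain_potential (ln 3))"
proof -
  have e: "2 * cosh (ln 3 / 2 :: real) = 4 / sqrt 3"
  proof -
    have "exp (ln 3 / 2 :: real) = sqrt 3"
      using powr_half_sqrt[of 3] by (simp add: powr_def)
    moreover have "sqrt 3 + 1 / sqrt 3 = 4 / sqrt (3 :: real)" by (simp add: field_simps)
    ultimately show ?thesis by (simp add: cosh_def exp_minus inverse_eq_divide)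
  qed
  have l4: "ln (4 :: real) = 2 * ln 2" using ln_realpow[of "2 :: real" 2] by simp
  have "chain_potential 0 - chain_potential (ln 3) = 6 * ln 3 - 8 * ln 2"
    unfolding chain_potential_def e by (simp add: ln_div ln_sqrt l4)
  also have "\<dots> = 2 * ln (27 / 16)"
    using ln_realpow[of "2 :: real" 4] ln_realpow[of "3 :: real" 3] by (simp add: ln_div)
  finally have p: "chain_potential 0 - chain_potential (ln 3) = 2 * ln (27 / 16)" .
  \<comment> \<open>Two rational bounds suffice: \<open>ln (27 / 16)\<close> is at least 11/27, and
    \<open>ln 3\<close> is at most 5/4 because \<open>(5 / 4) ^ 5 = 3125 / 1024\<close> exceeds 3.
    Finally 25/16 is below 44/27.\<close>
  have "ln (16 / 27 :: real) \<le> 16 / 27 - 1" by (rule ln_le_minus_one) simp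
  hence b1: "11 / 27 \<le> ln (27 / 16 :: real)" by (simp add: ln_div)
  have "(5 / 4 :: real) ^ 5 \<le> exp (1 / 4) ^ 5"
    using exp_ge_add_one_self[of "1 / 4 :: real"] by (intro power_mono) auto
  also have "\<dots> = exp (5 / 4)" by (simp flip: exp_of_nat_mult)
  finally have "3 \<le> exp (5 / 4 :: real)" by (simp add: power_numeral_reduce)
  hence "ln 3 \<le> (5 / 4 :: real)" by (metis exp_gt_zero exp_le_cancel_iff exp_ln zero_less_numeral)
  hence "(ln 3)\<^sup>2 \<le> (5 / 4 :: real)\<^sup>2" by (intro power_mono) auto
  thus ?thesis unfolding p using b1 by (simp add: power2_eq_square)
qed

text \<open>Every coordinate enters at most two differences, and a squared difference is at most
  twice the sum of the squares. This gives a factor 4, and the fourfold rows another 4.\<close>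

lemma chain_matrix_vnorm_le:
  assumes c: "c \<in> carrier_vec n"
  shows "vnorm (chain_matrix n *\<^sub>v c) \<le> 4 * vnorm c"
proof (rule power2_le_imp_le)
  have "(vnorm (chain_matrix n *\<^sub>v c))\<^sup>2 = (\<Sum>i<4 * n. (diff_vec c (i div 4))\<^sup>2)"
    unfolding vnorm_power2 using c
    by (intro sum.cong) (auto simp: chain_matrix_mult, simp_all add: chain_matrix_def)
  also have "\<dots> = 4 * (\<Sum>q<n. (diff_vec c q)\<^sup>2)"
    unfolding sum_blocks_of_4 sum_distrib_left by (intro sum.cong) (auto simp: div_mod_4)
  also have "\<dots> \<le> 4 * (\<Sum>q<n. 2 * (c $ q)\<^sup>2 + 2 * (if Suc q < n then (c $ Suc q)\<^sup>2 else 0))"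
  proof (intro mult_left_mono sum_mono)
    fix q
    have "(a - b)\<^sup>2 \<le> 2 * a\<^sup>2 + 2 * b\<^sup>2" for a b :: real
      using zero_le_power2[of "a + b"] by (simp add: power2_eq_square algebra_simps)
    from this[of "c $ q" "if Suc q < n then c $ Suc q else 0"]
    show "(diff_vec c q)\<^sup>2 \<le> 2 * (c $ q)\<^sup>2 + 2 * (if Suc q < n then (c $ Suc q)\<^sup>2 else 0)"
      using c by (auto simp: diff_vec_def)
  qed simp
  also have "\<dots> = 8 * (\<Sum>q<n. (c $ q)\<^sup>2) + 8 * (\<Sum>q<n. if Suc q < n then (c $ Suc q)\<^sup>2 else 0)"
    by (simp add: sum.distrib flip: sum_distrib_left)
  also have "(\<Sum>q<n. if Suc q < n then (c $ Suc q)\<^sup>2 else 0) \<le> (\<Sum>q<n. (c $ q)\<^sup>2)"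
  proof (cases n)
    case (Suc m)
    have "(\<Sum>q<n. if Suc q < n then (c $ Suc q)\<^sup>2 else 0) = (\<Sum>q<m. (c $ Suc q)\<^sup>2)"
      by (simp add: Suc)
    thus ?thesis unfolding Suc by (simp only: sum.lessThan_Suc_shift) simp
  qed simp
  finally show "(vnorm (chain_matrix n *\<^sub>v c))\<^sup>2 \<le> (4 * vnorm c)\<^sup>2"
    using c by (simp add: power_mult_distrib vnorm_power2)
qed (simp add: vnorm_nonneg)

text \<open>The zero vector serves twice: the supremum ranges over a nonempty set, and it is
  nonnegative, so that the bound can be squared.\<close>

lemma spectral_norm_power2_le:
  assumes "\<And>x. x \<in> carrier_vec (dim_col A) \<Longrightarrow> vnorm (A *\<^sub>v x) \<le> K * vnorm x" and "K \<ge> 0"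
  shows "(spectral_norm A)\<^sup>2 \<le> K\<^sup>2"
proof (rule power_mono)
  let ?B = "{x \<in> carrier_vec (dim_col A). vnorm x \<le> 1}"
  have le: "vnorm (A *\<^sub>v x) \<le> K" if "x \<in> ?B" for x
    using assms(1)[of x] that mult_left_mono[of "vnorm x" 1 K] assms(2) by auto
  have z: "0\<^sub>v (dim_col A) \<in> ?B" by (simp add: vnorm_def)
  show "spectral_norm A \<le> K"
    unfolding spectral_norm_def using z le by (intro cSUP_least) blast+
  have "vnorm (A *\<^sub>v 0\<^sub>v (dim_col A)) \<le> spectral_norm A"
    unfolding spectral_norm_def using z le by (intro cSUP_upper bdd_aboveI2[of _ _ K]) auto
  thus "0 \<le> spectral_norm A"
    using vnorm_nonneg[of "A *\<^sub>v 0\<^sub>v (dim_col A)"] by linarith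
qed

subsection \<open>The rotated chain\<close>

definition chain_minimizer :: "nat \<Rightarrow> real vec" where
  "chain_minimizer n = vec n (\<lambda>q. ln 3 * real (n - q))"

lemma diff_vec_chain_minimizer: "q < n \<Longrightarrow> diff_vec (chain_minimizer n) q = ln 3"
  by (cases "Suc q = n") (auto simp: diff_vec_def chain_minimizer_def of_nat_diff algebra_simps)

text \<open>The last difference is the last entry itself, so the entries are determined backwards;
  \<open>k\<close> counts from the end. This yields uniqueness of the minimizer.\<close>

lemma diff_vec_const_imp_chain_minimizer:
  assumes c: "c \<in> carrier_vec n" and d: "\<And>q. q < n \<Longrightarrow> diff_vec c q = ln 3"
  shows "c = chain_minimizer n"
proof (rule eq_vecI)
  have *: "c $ (n - Suc k) = ln 3 * real (Suc k)" if "k < n" for k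
    using that
  proof (induction k)
    case 0
    thus ?case using d[of "n - 1"] c by (simp add: diff_vec_def)
  next
    case (Suc k)
    have "Suc (n - Suc (Suc k)) = n - Suc k" using Suc.prems by simp
    thus ?case using d[of "n - Suc (Suc k)"] c Suc by (simp add: diff_vec_def algebra_simps)
  qed
  fix i assume "i < dim_vec (chain_minimizer n)"
  hence "i < n" by (simp add: chain_minimizer_def)
  thus "c $ i = chain_minimizer n $ i"
    using *[of "n - Suc i"] by (simp add: chain_minimizer_def Suc_diff_Suc)
qed (use c in \<open>simp add: chain_minimizer_def\<close>)

lemma logistic_loss_mult:
  assumes "W \<in> carrier_mat N n" "V \<in> carrier_mat n n" "x \<in> carrier_vec n"
  shows "logistic_loss (W * V) b x = logistic_loss W b (V *\<^sub>v x)"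
  using assms by (simp add: logistic_loss_def assoc_mult_mat_vec[of _ N n _ n])

lemma logistic_gradient_mult:
  assumes "W \<in> carrier_mat N n" "V \<in> carrier_mat n n" "x \<in> carrier_vec n" "b \<in> carrier_vec N"
  shows "logistic_gradient (W * V) b x = V\<^sup>T *\<^sub>v logistic_gradient W b (V *\<^sub>v x)"
proof -
  have w: "map_vec (\<lambda>u. tanh (u / 2)) (W *\<^sub>v (V *\<^sub>v x)) - b \<in> carrier_vec N"
    by (rule carrier_vecI) (use assms in simp)
  show ?thesis
    using assms w unfolding logistic_gradient_def
    by (simp add: assoc_mult_mat_vec[of W N n V n] transpose_mult[of W N n V n]
        assoc_mult_mat_vec[of "V\<^sup>T" n n "W\<^sup>T" N])
qed

text \<open>Answering with the gradient fixes an oracle before any subgradient selection is given;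
  every selection turns out to agree with it on the carrier.\<close>

definition rotated_oracle :: "nat \<Rightarrow> real mat \<Rightarrow> real vec \<Rightarrow> oracle_answer" where
  "rotated_oracle n V = first_order_oracle
     (logistic_loss (chain_matrix n * V) (chain_response n))
     (logistic_gradient (chain_matrix n * V) (chain_response n))"

text \<open>The answer depends on \<open>V\<close> only through \<open>V *\<^sub>v x\<close> and the
  chain gradient at that point, pulled back by the transpose. Both vanish from \<open>m + 1\<close>
  on, hence from \<open>k\<close> on, so the symmetric \<open>Q\<close> fixes them: answers already
  given stay valid after the change of data.\<close>

lemma rotated_oracle_cong:
  assumes V: "V \<in> carrier_mat n n" and Q: "Q \<in> carrier_mat n n" "Q\<^sup>T = Q"
    and fixed: "\<And>v. v \<in> carrier_vec n \<Longrightarrow> vanishes_from k v \<Longrightarrow> Q *\<^sub>v v = v"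
    and x: "x \<in> carrier_vec n" "vanishes_from m (V *\<^sub>v x)" and m: "m < k"
  shows "rotated_oracle n (Q * V) x = rotated_oracle n V x"
proof -
  have Vx: "V *\<^sub>v x \<in> carrier_vec n" using V x by simp
  have QVx: "Q * V *\<^sub>v x = V *\<^sub>v x"
    using fixed[OF Vx vanishes_from_mono[OF x(2)]] m V Q x by (simp add: assoc_mult_mat_vec[of _ n n _ n])
  let ?G = "logistic_gradient (chain_matrix n) (chain_response n) (V *\<^sub>v x)"
  have G: "?G \<in> carrier_vec n"
    by (rule logistic_gradient_carrier[OF chain_matrix_carrier chain_response_carrier])
  have "Q *\<^sub>v ?G = ?G"
    using m by (intro fixed G vanishes_from_mono[OF chain_gradient_vanishes[OF Vx x(2)]]) simp
  hence "(Q * V)\<^sup>T *\<^sub>v ?G = V\<^sup>T *\<^sub>v ?G"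
    using Q V G by (simp add: transpose_mult[of Q n n V n] assoc_mult_mat_vec[of _ n n _ n])
  moreover have "Q * V \<in> carrier_mat n n" using Q V by simp
  ultimately show ?thesis
    using V x QVx unfolding rotated_oracle_def first_order_oracle_def
    by (simp add: logistic_loss_mult[OF chain_matrix_carrier]
        logistic_gradient_mult[OF chain_matrix_carrier _ _ chain_response_carrier])
qed

text \<open>A deterministic run sees an oracle only at its own iterates, so agreement along one of
  the two runs is enough.\<close>

lemma iterate_cong:
  assumes "\<And>s. s < t \<Longrightarrow> O1 (iterate M n O1 s) = O2 (iterate M n O1 s)"
  shows "iterate M n O1 t = iterate M n O2 t"
  using assms
proof (induction t rule: less_induct)
  case (less t)
  show ?case
  proof (cases t)
    case (Suc r)
    have "O1 (iterate M n O1 s) = O2 (iterate M n O2 s)" if "s < t" for s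
      using less.IH[OF that] less.prems that by (metis less_trans)
    hence "map (\<lambda>s. O1 (iterate M n O1 s)) [0..<t] = map (\<lambda>s. O2 (iterate M n O2 s)) [0..<t]"
      by simp
    thus ?thesis unfolding Suc by (simp only: iterate.simps)
  qed simp
qed

lemma iterate_carrier:
  assumes M: "deterministic_fom M"
    and O: "\<And>x. x \<in> carrier_vec n \<Longrightarrow> snd (Or x) \<in> carrier_vec n"
  shows "iterate M n Or t \<in> carrier_vec n"
proof (induction t rule: less_induct)
  case (less t)
  show ?case
  proof (cases t)
    case 0
    thus ?thesis using M by (simp add: deterministic_fom_def)
  next
    case (Suc r)
    let ?os = "map (\<lambda>s. Or (iterate M n Or s)) [0..<Suc r]"
    have "length ?os = Suc r" "snd ` set ?os \<subseteq> carrier_vec n"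
      using O less Suc by (auto simp del: upt_Suc)
    thus ?thesis using M unfolding Suc iterate.simps deterministic_fom_def by blast
  qed
qed

lemma rotated_oracle_carrier:
  "V \<in> carrier_mat n n \<Longrightarrow> snd (rotated_oracle n V x) \<in> carrier_vec n"
  unfolding rotated_oracle_def first_order_oracle_def snd_conv
  by (rule logistic_gradient_carrier[OF mult_carrier_mat[OF chain_matrix_carrier] chain_response_carrier])

text \<open>Each iteration uses up two coordinates: one that the gradient at the current iterate may
  reveal, and one that absorbs the unrevealed part of the next iterate.\<close>

lemma resisting_rotation:
  assumes M: "deterministic_fom M" and init: "\<And>n. fom_init M n = 0\<^sub>v n"
  shows "2 * t < n \<Longrightarrow> \<exists>V. orthogonal n V \<and>
    (\<forall>s\<le>t. vanishes_from (2 * s) (V *\<^sub>v iterate M n (rotated_oracle n V) s))"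
proof (induction t)
  case 0
  have "vanishes_from 0 (1\<^sub>m n *\<^sub>v iterate M n (rotated_oracle n (1\<^sub>m n)) 0)"
    by (simp add: init vanishes_from_def)
  thus ?case using orthogonal_one by fastforce
next
  case (Suc t)
  then obtain V where V: "orthogonal n V"
    and van: "\<And>s. s \<le> t \<Longrightarrow> vanishes_from (2 * s) (V *\<^sub>v iterate M n (rotated_oracle n V) s)"
    by auto
  have VC: "V \<in> carrier_mat n n" using V by (simp add: orthogonal_def)
  define x where "x = iterate M n (rotated_oracle n V)"
  have x: "x s \<in> carrier_vec n" for s
    unfolding x_def using M VC by (intro iterate_carrier rotated_oracle_carrier)
  \<comment> \<open>Answers up to step \<open>t\<close> live on the first \<open>2 * t + 1\<close>
    coordinates, which \<open>Q\<close> must therefore fix; the remaining part of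
    \<open>V *\<^sub>v x (Suc t)\<close> is moved into the coordinate with index
    \<open>2 * t + 1\<close>.\<close>
  have "V *\<^sub>v x (Suc t) \<in> carrier_vec n" "2 * t + 1 < n" using VC x Suc.prems by auto
  then obtain Q where Q: "orthogonal n Q" "Q\<^sup>T = Q"
    and fixed: "\<And>v. v \<in> carrier_vec n \<Longrightarrow> vanishes_from (2 * t + 1) v \<Longrightarrow> Q *\<^sub>v v = v"
    and Qx: "vanishes_from (Suc (2 * t + 1)) (Q *\<^sub>v (V *\<^sub>v x (Suc t)))"
    using householder by metis
  have QC: "Q \<in> carrier_mat n n" using Q by (simp add: orthogonal_def)
  have QV: "Q * V *\<^sub>v x s = Q *\<^sub>v (V *\<^sub>v x s)" for s
    using QC VC x by (simp add: assoc_mult_mat_vec[of _ n n _ n])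
  \<comment> \<open>The new data \<open>Q * V\<close> reproduce the run up to \<open>Suc t\<close>,
    so the reflection was chosen for the very iterate that the method produces on them.\<close>
  have same: "iterate M n (rotated_oracle n (Q * V)) s = x s" if "s \<le> Suc t" for s
    unfolding x_def
  proof (rule iterate_cong[symmetric])
    fix r assume "r < s"
    thus "rotated_oracle n V (iterate M n (rotated_oracle n V) r)
      = rotated_oracle n (Q * V) (iterate M n (rotated_oracle n V) r)"
      using that van[of r] x[of r] QC Q VC unfolding x_def
      by (intro rotated_oracle_cong[symmetric, of _ _ _ "2 * t + 1" _ "2 * r"] fixed) auto
  qed
  have "vanishes_from (2 * s) (Q * V *\<^sub>v x s)" if "s \<le> Suc t" for s
  proof (cases "s = Suc t")
    case True
    thus ?thesis using Qx QV by simp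
  next
    case False
    hence v: "vanishes_from (2 * s) (V *\<^sub>v x s)" using van that by (simp add: x_def)
    have "Q *\<^sub>v (V *\<^sub>v x s) = V *\<^sub>v x s"
      using False that VC x by (intro fixed vanishes_from_mono[OF v]) auto
    thus ?thesis using v QV by simp
  qed
  thus ?case using orthogonal_mult[OF Q(1) V] same by (intro exI[of _ "Q * V"]) auto
qed

lemma sum_countdown_squares:
  "6 * (\<Sum>q<n. (real (n - q))\<^sup>2) = real n * (real n + 1) * (2 * real n + 1)"
proof -
  have "(\<Sum>q<n. (real (n - q))\<^sup>2) = (\<Sum>q<n. (real (Suc q))\<^sup>2)"
    by (rule sum.reindex_bij_witness[of _ "\<lambda>q. n - Suc q" "\<lambda>q. n - Suc q"])
      (auto simp: Suc_diff_Suc simp del: of_nat_Suc)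
  moreover have "6 * (\<Sum>q<n. (real (Suc q))\<^sup>2) = real n * (real n + 1) * (2 * real n + 1)"
    by (induction n) (simp_all add: algebra_simps power2_eq_square)
  ultimately show ?thesis by simp
qed

theorem theorem3p3:
  fixes M :: fom and T :: nat
  assumes "deterministic_fom M"
    and "\<And>n. fom_init M n = 0\<^sub>v n"
    and "T > 0"
  shows "\<exists>A \<in> carrier_mat (16 * T + 8) (4 * T + 2). \<exists>b z.
    is_response (16 * T + 8) b \<and>
    is_the_minimizer (4 * T + 2) (logistic_loss A b) z \<and>
    (\<forall>f'. subgradient_selection (4 * T + 2) (logistic_loss A b) f' \<longrightarrow>
      (let x = iterate M (4 * T + 2) (first_order_oracle (logistic_loss A b) f') in
        logistic_loss A b (x T) - min_value (4 * T + 2) (logistic_loss A b)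
          \<ge> 3 * (spectral_norm A)\<^sup>2 * (vnorm (x 0 - z))\<^sup>2
              / (32 * (4 * real T + 3) * (8 * real T + 5)) \<and>
        (vnorm (x T - z))\<^sup>2 > 1 / 8 * (vnorm (x 0 - z))\<^sup>2))"
proof -
  define n where "n = 4 * T + 2"
  have N: "16 * T + 8 = 4 * n" by (simp add: n_def)
  have "2 * T < n" by (simp add: n_def)
  then obtain V where V: "orthogonal n V"
    and van: "vanishes_from (2 * T) (V *\<^sub>v iterate M n (rotated_oracle n V) T)"
    using resisting_rotation[OF assms(1,2)] by blast
  have VC: "V \<in> carrier_mat n n" using V by (simp add: orthogonal_def)
  define A where "A = chain_matrix n * V"
  define b where "b = chain_response n"
  define z where "z = V\<^sup>T *\<^sub>v chain_minimizer n"
  have AC: "A \<in> carrier_mat (4 * n) n"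
    unfolding A_def by (rule mult_carrier_mat[OF chain_matrix_carrier VC])
  have bC: "b \<in> carrier_vec (4 * n)" unfolding b_def by (rule chain_response_carrier)
  have cmC: "chain_minimizer n \<in> carrier_vec n" by (simp add: chain_minimizer_def)
  have zC: "z \<in> carrier_vec n" using VC cmC by (simp add: z_def)
  have Vz: "V *\<^sub>v z = chain_minimizer n"
    using V VC cmC by (simp add: z_def orthogonal_def flip: assoc_mult_mat_vec[of _ n n _ n])
  have loss: "logistic_loss A b x = (\<Sum>q<n. chain_potential (diff_vec (V *\<^sub>v x) q))"
    if "x \<in> carrier_vec n" for x
    using that VC by (simp add: A_def b_def logistic_loss_mult[OF chain_matrix_carrier VC] chain_loss)
  have lossz: "logistic_loss A b z = (\<Sum>q<n. chain_potential (ln 3))"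
    unfolding loss[OF zC] Vz by (intro sum.cong) (auto simp: diff_vec_chain_minimizer)
  have resp: "is_response (4 * n) b"
    using bC by (auto simp: is_response_def b_def chain_response_def)
  have strict: "logistic_loss A b z < logistic_loss A b x" if x: "x \<in> carrier_vec n" "x \<noteq> z" for x
  proof -
    have VxC: "V *\<^sub>v x \<in> carrier_vec n" using VC x by simp
    have "\<exists>q<n. diff_vec (V *\<^sub>v x) q \<noteq> ln 3"
    proof (rule ccontr)
      assume "\<not> (\<exists>q<n. diff_vec (V *\<^sub>v x) q \<noteq> ln 3)"
      hence "V *\<^sub>v x = chain_minimizer n"
        by (intro diff_vec_const_imp_chain_minimizer VxC) auto
      hence "V\<^sup>T *\<^sub>v (V *\<^sub>v x) = z" by (simp add: z_def)
      moreover have "V\<^sup>T *\<^sub>v (V *\<^sub>v x) = x"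
        using V VC x by (simp add: orthogonal_def flip: assoc_mult_mat_vec[of _ n n _ n])
      ultimately show False using x by simp
    qed
    then obtain q where "q < n" "diff_vec (V *\<^sub>v x) q \<noteq> ln 3" by blast
    thus ?thesis
      unfolding lossz loss[OF x(1)]
      by (intro sum_strict_mono_ex1) (auto intro!: chain_potential_min_le chain_potential_min)
  qed
  have minim: "is_the_minimizer n (logistic_loss A b) z"
    using zC strict by (simp add: is_the_minimizer_def)
  have minval: "min_value n (logistic_loss A b) = logistic_loss A b z"
    unfolding min_value_def using zC strict
    by (intro Least_equality) (auto intro: less_imp_le)
  have spec: "(spectral_norm A)\<^sup>2 \<le> 16"
  proof -
    have "vnorm (A *\<^sub>v x) \<le> 4 * vnorm x" if "x \<in> carrier_vec n" for x
      using chain_matrix_vnorm_le[of "V *\<^sub>v x" n] that VC orthogonal_vnorm[OF V that]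
      by (simp add: A_def assoc_mult_mat_vec[OF chain_matrix_carrier VC])
    thus ?thesis using spectral_norm_power2_le[of A 4] AC by simp
  qed
  have main: "logistic_loss A b (x T) - min_value n (logistic_loss A b)
        \<ge> 3 * (spectral_norm A)\<^sup>2 * (vnorm (x 0 - z))\<^sup>2 / (32 * (4 * real T + 3) * (8 * real T + 5)) \<and>
      (vnorm (x T - z))\<^sup>2 > 1 / 8 * (vnorm (x 0 - z))\<^sup>2"
    if f': "subgradient_selection n (logistic_loss A b) f'"
      and x_def: "x = iterate M n (first_order_oracle (logistic_loss A b) f')" for f' x
  proof -
    have f'_eq: "f' y = logistic_gradient A b y" if "y \<in> carrier_vec n" for y
      using f' that subgradient_logistic_loss_iff[OF AC bC that, of "f' y"]
      by (auto simp: subgradient_selection_def)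
    have roC: "iterate M n (rotated_oracle n V) t \<in> carrier_vec n" for t
      using assms(1) VC by (intro iterate_carrier rotated_oracle_carrier)
    \<comment> \<open>By uniqueness of subgradients any \<open>f'\<close> agrees with the gradient
      on the carrier, which the iterates never leave; so the run is the one that \<open>V\<close>
      was built against.\<close>
    have x_eq: "x t = iterate M n (rotated_oracle n V) t" for t
      unfolding x_def
    proof (rule iterate_cong[symmetric])
      have "rotated_oracle n V y = first_order_oracle (logistic_loss A b) f' y"
        if y: "y \<in> carrier_vec n" for y
        using f'_eq[OF y] by (simp add: rotated_oracle_def first_order_oracle_def A_def b_def)
      thus "rotated_oracle n V (iterate M n (rotated_oracle n V) s)
        = first_order_oracle (logistic_loss A b) f' (iterate M n (rotated_oracle n V) s)" for s
        using roC .
    qed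
    define c where "c = V *\<^sub>v x T"
    have xC: "x t \<in> carrier_vec n" for t using roC x_eq by simp
    have cC: "c \<in> carrier_vec n" using VC xC by (simp add: c_def)
    have c0: "c $ q = 0" if "2 * T \<le> q" "q < n" for q
      using vanishes_fromD[OF van, of q] that VC by (simp add: c_def x_eq)
    have dist0: "(vnorm (x 0 - z))\<^sup>2 = (ln 3)\<^sup>2 * (\<Sum>q<n. (real (n - q))\<^sup>2)"
    proof -
      have "x 0 - z = - z" using zC by (simp add: x_def assms(2))
      hence "(vnorm (x 0 - z))\<^sup>2 = (vnorm z)\<^sup>2" using zC by (simp add: vnorm_power2)
      also have "\<dots> = (vnorm (chain_minimizer n))\<^sup>2"
        using orthogonal_vnorm[OF V zC] Vz by simp
      also have "\<dots> = (ln 3)\<^sup>2 * (\<Sum>q<n. (real (n - q))\<^sup>2)"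
        by (simp add: vnorm_power2 chain_minimizer_def power_mult_distrib sum_distrib_left)
      finally show ?thesis .
    qed
    \<comment> \<open>The number of trailing coordinates, and of trailing differences, that are
      still 0 at \<open>x T\<close>.\<close>
    define m where "m = 2 * T + 2"
    have nm: "n = 2 * T + m" by (simp add: n_def m_def)
    have "(ln 3)\<^sup>2 * (\<Sum>q<m. (real (m - q))\<^sup>2) \<le> (vnorm (x T - z))\<^sup>2"
    proof -
      have "(vnorm (x T - z))\<^sup>2 = (vnorm (V *\<^sub>v (x T - z)))\<^sup>2"
        using orthogonal_vnorm[OF V, of "x T - z"] xC zC by simp
      also have "V *\<^sub>v (x T - z) = c - chain_minimizer n"
        unfolding c_def mult_minus_distrib_mat_vec[OF VC xC zC] Vz ..
      also have "(vnorm \<dots>)\<^sup>2 = (\<Sum>q<n. (c $ q - ln 3 * real (n - q))\<^sup>2)"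
        by (simp add: vnorm_power2 chain_minimizer_def)
      also have "\<dots> \<ge> (\<Sum>q\<in>{2 * T..<n}. (c $ q - ln 3 * real (n - q))\<^sup>2)"
        by (rule sum_mono2) auto
      also have "(\<Sum>q\<in>{2 * T..<n}. (c $ q - ln 3 * real (n - q))\<^sup>2)
        = (\<Sum>q\<in>{2 * T..<n}. (ln 3)\<^sup>2 * (real (n - q))\<^sup>2)"
        by (intro sum.cong) (auto simp: c0 power_mult_distrib)
      also have "\<dots> = (\<Sum>q<m. (ln 3)\<^sup>2 * (real (m - q))\<^sup>2)"
        by (rule sum.reindex_bij_witness[of _ "\<lambda>q. q + 2 * T" "\<lambda>q. q - 2 * T"])
          (auto simp: nm)
      finally show ?thesis by (simp add: sum_distrib_left)
    qed
    moreover have "8 * (\<Sum>q<m. (real (m - q))\<^sup>2) > (\<Sum>q<n. (real (n - q))\<^sup>2)"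
    proof -
      have "real n = 4 * real T + 2" "real m = 2 * real T + 2" by (simp_all add: n_def m_def)
      \<comment> \<open>With \<open>n = 2 * m - 2\<close> the left side is
        \<open>2 * m * (2 * m + 2) * (4 * m + 2)\<close>, which dominates
        \<open>n * (n + 1) * (2 * n + 1)\<close> factor by factor.\<close>
      hence "8 * (real m * (real m + 1) * (2 * real m + 1)) > real n * (real n + 1) * (2 * real n + 1)"
        by (simp add: algebra_simps) (use assms(3) in \<open>simp add: add_pos_nonneg\<close>)
      thus ?thesis using sum_countdown_squares[of n] sum_countdown_squares[of m] by linarith
    qed
    moreover have l3: "(ln 3 :: real)\<^sup>2 > 0" by simp
    ultimately have part2: "(vnorm (x T - z))\<^sup>2 > 1 / 8 * (vnorm (x 0 - z))\<^sup>2"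
      unfolding dist0
      using mult_strict_left_mono[of "\<Sum>q<n. (real (n - q))\<^sup>2" "8 * (\<Sum>q<m. (real (m - q))\<^sup>2)" "(ln 3)\<^sup>2"]
      by linarith
    define g where "g = chain_potential 0 - chain_potential (ln 3)"
    have "logistic_loss A b (x T) - logistic_loss A b z
        = (\<Sum>q<n. chain_potential (diff_vec c q) - chain_potential (ln 3))"
      by (simp add: loss[OF xC] lossz c_def sum_subtractf)
    \<comment> \<open>The dropped blocks contribute nonnegative amounts. Each remaining difference
      is 0, also the last one thanks to the boundary convention, and contributes exactly
      \<open>g\<close>.\<close>
    also have "\<dots> \<ge> (\<Sum>q\<in>{2 * T..<n}. chain_potential (diff_vec c q) - chain_potential (ln 3))"
      by (rule sum_mono2) (auto simp: chain_potential_min_le)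
    also have "(\<Sum>q\<in>{2 * T..<n}. chain_potential (diff_vec c q) - chain_potential (ln 3))
        = (\<Sum>q\<in>{2 * T..<n}. g)"
      using cC by (intro sum.cong) (auto simp: g_def diff_vec_def c0)
    also have "\<dots> = real m * g" by (simp add: nm)
    finally have gap: "logistic_loss A b (x T) - logistic_loss A b z \<ge> real m * g" .
    have dist0_eq: "(vnorm (x 0 - z))\<^sup>2 = (ln 3)\<^sup>2 * ((4 * real T + 2) * (4 * real T + 3) * (8 * real T + 5) / 6)"
    proof -
      have n: "real n = 4 * real T + 2" "4 * real T + 2 + 1 = 4 * real T + 3"
        "2 * (4 * real T + 2) + 1 = 8 * real T + 5"
        by (simp_all add: n_def)
      have "(\<Sum>q<n. (real (n - q))\<^sup>2) = (4 * real T + 2) * (4 * real T + 3) * (8 * real T + 5) / 6"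
        using sum_countdown_squares[of n, unfolded n] by linarith
      thus ?thesis by (simp only: dist0)
    qed
    \<comment> \<open>With the squared norm of \<open>A\<close> bounded by 16, the closed form of
      the initial distance cancels both factors of the denominator. The remaining
      \<open>2 * T + 1\<close> multiples of \<open>g\<close> are one fewer than the \<open>m\<close>
      available.\<close>
    have "3 * (spectral_norm A)\<^sup>2 * (vnorm (x 0 - z))\<^sup>2 / (32 * (4 * real T + 3) * (8 * real T + 5))
        \<le> 3 * 16 * ((ln 3)\<^sup>2 * ((4 * real T + 2) * (4 * real T + 3) * (8 * real T + 5) / 6))
          / (32 * (4 * real T + 3) * (8 * real T + 5))"
      unfolding dist0_eq using spec by (intro divide_right_mono mult_right_mono) auto
    also have "\<dots> = (ln 3)\<^sup>2 * (4 * real T + 2) / 4"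
    proof -
      have "3 * 16 * (l * (a * b * d / 6)) / (32 * b * d) = l * a / 4"
        if "b \<noteq> 0" "d \<noteq> 0" for l a b d :: real
        using that by (simp add: field_simps)
      moreover have "4 * real T + 3 \<noteq> 0" "8 * real T + 5 \<noteq> 0"
        by (simp_all add: add_nonneg_eq_0_iff)
      ultimately show ?thesis .
    qed
    also have "\<dots> \<le> 2 * g * (4 * real T + 2) / 4"
      using chain_potential_gap by (intro divide_right_mono mult_right_mono) (auto simp: g_def)
    also have "\<dots> = g * (2 * real T + 1)" by simp
    also have "\<dots> \<le> real m * g"
      using chain_potential_min_le[of 0] by (simp add: m_def g_def algebra_simps)
    also note gap
    finally show ?thesis using part2 unfolding minval by blast
  qed
  show ?thesis
    unfolding N n_def[symmetric] Let_def
  proof (rule bexI[of _ A], rule exI[of _ b], rule exI[of _ z], intro conjI resp minim,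
      rule allI, rule impI)
    fix f' assume "subgradient_selection n (logistic_loss A b) f'"
    from main[OF this refl] show "logistic_loss A b (iterate M n (first_order_oracle (logistic_loss A b) f') T)
          - min_value n (logistic_loss A b)
        \<ge> 3 * (spectral_norm A)\<^sup>2
            * (vnorm (iterate M n (first_order_oracle (logistic_loss A b) f') 0 - z))\<^sup>2
            / (32 * (4 * real T + 3) * (8 * real T + 5)) \<and>
      (vnorm (iterate M n (first_order_oracle (logistic_loss A b) f') T - z))\<^sup>2
        > 1 / 8 * (vnorm (iterate M n (first_order_oracle (logistic_loss A b) f') 0 - z))\<^sup>2" .
  qed (rule AC)
qed

end
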